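(* The class $\{K_e(cp(n)) : n\in\mathbb{N}\}$ of edge-clique graphs of cocktail party graphs has unbounded rankwidth; that is, for every $k$ there exists $n$ such that the rankwidth of $K_e(cp(n))$ exceeds $k$.
   Context: The cocktail party graph $cp(n)$ is the complement of a perfect matching on $2n$ vertices. The edge-clique graph $K_e(G)$ of a graph $G$ has the edges of $G$ as its vertices, two of them adjacent when the corresponding edges are contained in a common clique of $G$. Rankwidth is the standard graph width parameter of Oum and Seymour. *)

theory Defs
  imports Complex_Main "HOL-Library.Z2" "HOL-Library.Function_Algebras"
begin

text \<open>Undirected graphs are pairs (vertex set, set of two-element edge sets).\<close>

type_synonym 'a ugraph = "'a set \<times> 'a set set"

abbreviation verts :: "'a ugraph \<Rightarrow> 'a set" where "verts G \<equiv> fst G"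

abbreviation edges :: "'a ugraph \<Rightarrow> 'a set set" where "edges G \<equiv> snd G"

definition simple_graph :: "'a ugraph \<Rightarrow> bool" where
  "simple_graph G \<longleftrightarrow> finite (verts G) \<and> (\<forall>e\<in>edges G. e \<subseteq> verts G \<and> card e = 2)"

definition complement :: "'a ugraph \<Rightarrow> 'a ugraph" where
  "complement G = (verts G, {e. e \<subseteq> verts G \<and> card e = 2 \<and> e \<notin> edges G})"

definition clique :: "'a ugraph \<Rightarrow> 'a set \<Rightarrow> bool" where
  "clique G C \<longleftrightarrow> C \<subseteq> verts G \<and> (\<forall>u\<in>C. \<forall>v\<in>C. u \<noteq> v \<longrightarrow> {u, v} \<in> edges G)"

definition matching_graph :: "nat \<Rightarrow> (nat \<times> bool) ugraph" where
  "matching_graph n = ({..<n} \<times> UNIV, {{(i, False), (i, True)} | i. i < n})"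

definition cp :: "nat \<Rightarrow> (nat \<times> bool) ugraph" where
  "cp n = complement (matching_graph n)"

definition edge_clique_graph :: "'a ugraph \<Rightarrow> 'a set ugraph" where
  "edge_clique_graph G =
     (edges G,
      {{e, f} | e f. e \<in> edges G \<and> f \<in> edges G \<and> e \<noteq> f \<and>
                     (\<exists>C. clique G C \<and> e \<subseteq> C \<and> f \<subseteq> C)})"

definition reachable :: "'a ugraph \<Rightarrow> 'a \<Rightarrow> 'a \<Rightarrow> bool" where
  "reachable G u v \<longleftrightarrow> (u, v) \<in> {(x, y). {x, y} \<in> edges G}\<^sup>*"

definition connected_graph :: "'a ugraph \<Rightarrow> bool" where
  "connected_graph G \<longleftrightarrow>
     verts G \<noteq> {} \<and> (\<forall>u\<in>verts G. \<forall>v\<in>verts G. reachable G u v)"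

definition is_cycle :: "'a ugraph \<Rightarrow> 'a list \<Rightarrow> bool" where
  "is_cycle G vs \<longleftrightarrow>
     3 \<le> length vs \<and> distinct vs \<and> set vs \<subseteq> verts G \<and>
     (\<forall>i. Suc i < length vs \<longrightarrow> {vs ! i, vs ! Suc i} \<in> edges G) \<and>
     {last vs, hd vs} \<in> edges G"

definition is_tree :: "'a ugraph \<Rightarrow> bool" where
  "is_tree G \<longleftrightarrow> simple_graph G \<and> connected_graph G \<and> (\<nexists>vs. is_cycle G vs)"

definition degree :: "'a ugraph \<Rightarrow> 'a \<Rightarrow> nat" where
  "degree G v = card {e \<in> edges G. v \<in> e}"

definition leaves :: "'a ugraph \<Rightarrow> 'a set" where
  "leaves G = {v \<in> verts G. degree G v = 1}"

definition subcubic_tree :: "'a ugraph \<Rightarrow> bool" where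
  "subcubic_tree T \<longleftrightarrow>
     is_tree T \<and> 2 \<le> card (verts T) \<and> (\<forall>t\<in>verts T. degree T t \<le> 3)"

abbreviation bit_scale :: "bit \<Rightarrow> ('a \<Rightarrow> bit) \<Rightarrow> 'a \<Rightarrow> bit" where
  "bit_scale \<equiv> \<lambda>c f x. c * f x"

lemma vector_space_bit_scale: "vector_space bit_scale"
  by unfold_locales (auto simp: fun_eq_iff algebra_simps)

text \<open>
  The row indexed by \<open>x\<close> of the GF(2) adjacency matrix between \<open>A\<close> and the
  remaining vertices, extended by zero to a function on the whole type.
\<close>

definition cut_row :: "'a ugraph \<Rightarrow> 'a set \<Rightarrow> 'a \<Rightarrow> 'a \<Rightarrow> bit" where
  "cut_row G A x = (\<lambda>y. if y \<in> verts G - A \<and> {x, y} \<in> edges G then 1 else 0)"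

definition cutrank :: "'a ugraph \<Rightarrow> 'a set \<Rightarrow> nat" where
  "cutrank G A = vector_space.dim bit_scale (cut_row G A ` A)"

definition rank_decomposition :: "'a ugraph \<Rightarrow> nat ugraph \<Rightarrow> ('a \<Rightarrow> nat) \<Rightarrow> bool" where
  "rank_decomposition G T L \<longleftrightarrow> subcubic_tree T \<and> bij_betw L (verts G) (leaves T)"

definition delete_edge :: "'a ugraph \<Rightarrow> 'a set \<Rightarrow> 'a ugraph" where
  "delete_edge G e = (verts G, edges G - {e})"

text \<open>
  The vertices of \<open>G\<close> sent by \<open>L\<close> into the component of \<open>T - e\<close> containing \<open>t\<close>.
\<close>

definition edge_side :: "'a ugraph \<Rightarrow> nat ugraph \<Rightarrow> ('a \<Rightarrow> nat) \<Rightarrow> nat set \<Rightarrow> nat \<Rightarrow> 'a set" where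
  "edge_side G T L e t = {v \<in> verts G. reachable (delete_edge T e) t (L v)}"

text \<open>
  Both ends \<open>t\<close> of each tree edge \<open>e\<close> are used. They give complementary vertex sets,
  which have the same cutrank, so this is the maximum over the tree edges.
\<close>

definition decomposition_width :: "'a ugraph \<Rightarrow> nat ugraph \<Rightarrow> ('a \<Rightarrow> nat) \<Rightarrow> nat" where
  "decomposition_width G T L =
     Max {cutrank G (edge_side G T L e t) | e t. e \<in> edges T \<and> t \<in> e}"

text \<open>
  Decomposition trees have natural numbers as nodes, which is no restriction since
  they are finite. Graphs with at most one vertex have no rank decomposition;
  following Oum and Seymour their rankwidth is the cutrank of the empty set.
\<close>

definition rankwidth :: "'a ugraph \<Rightarrow> nat" where
  "rankwidth G =
     (if card (verts G) \<le> 1 then cutrank G {}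
      else Inf {decomposition_width G T L | T L. rank_decomposition G T L})"

end

theory Submission
  imports Defs
begin

text \<open>
  In a subcubic tree some edge splits any large set of leaves into two large parts. Apply this
  to the edges of \<open>cp n\<close> joining \<open>(0, False)\<close> to some \<open>(j, False)\<close>, giving a partition \<open>A\<close>, \<open>B\<close> of
  the edges of \<open>cp n\<close>. Every index \<open>i\<close> has a probe, an edge at \<open>(i, True)\<close>, whose only
  non-neighbours among the edges \<open>{(a, False), (b, False)}\<close> are those with \<open>i \<in> {a, b}\<close>.
  If both cutranks are at most \<open>k\<close>, there are at most \<open>2 ^ k\<close> distinct rows on each side, so for
  all but boundedly many \<open>i\<close> every edge \<open>{(i, False), (j, False)}\<close> lies on the same side as the
  probe of \<open>i\<close>. Two such indices share an edge, so this is one common side for all of them, and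
  the other side contains only boundedly many of the chosen edges.
\<close>

section \<open>Reachability and paths in graphs\<close>

lemma reachable_sym: "reachable G u v \<Longrightarrow> reachable G v u"
proof -
  have "sym {(x, y). {x, y} \<in> edges G}"
    by (auto simp: sym_def insert_commute)
  then show "reachable G u v \<Longrightarrow> reachable G v u"
    unfolding reachable_def by (meson sym_rtrancl symD)
qed

lemma reachable_trans: "reachable G u v \<Longrightarrow> reachable G v w \<Longrightarrow> reachable G u w"
  unfolding reachable_def by (rule rtrancl_trans)

lemma reachable_refl: "reachable G u u"
  unfolding reachable_def by simp

lemma reachable_step: "reachable G u v \<Longrightarrow> {v, w} \<in> edges G \<Longrightarrow> reachable G u w"
  unfolding reachable_def by (simp add: rtrancl.rtrancl_into_rtrancl)

lemma reachable_induct [consumes 1, case_names refl step]: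
  assumes "reachable G u v" "P u"
    and "\<And>x y. reachable G u x \<Longrightarrow> {x, y} \<in> edges G \<Longrightarrow> P x \<Longrightarrow> P y"
  shows "P v"
  using assms(1) unfolding reachable_def
  by (induction rule: rtrancl_induct) (use assms(2,3) in \<open>auto simp: reachable_def\<close>)

lemma reachable_verts:
  assumes "simple_graph G" "reachable G u v" "u \<in> verts G"
  shows "v \<in> verts G"
  using assms(2)
  by (induction rule: reachable_induct) (use assms(1,3) in \<open>auto simp: simple_graph_def\<close>)

text \<open>A path is extended edge by edge; when the new vertex already lies on it, the path is cut
  back to that vertex instead.\<close>

lemma reachable_imp_distinct_path:
  assumes "reachable G u v"
  shows "\<exists>vs. vs \<noteq> [] \<and> distinct vs \<and> hd vs = u \<and> last vs = v \<and>
           (\<forall>i. Suc i < length vs \<longrightarrow> {vs ! i, vs ! Suc i} \<in> edges G)"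
  using assms
proof (induction rule: reachable_induct)
  case refl
  show ?case by (rule exI[of _ "[u]"]) simp
next
  case (step x y)
  then obtain vs where vs: "vs \<noteq> []" "distinct vs" "hd vs = u" "last vs = x"
    "\<forall>i. Suc i < length vs \<longrightarrow> {vs ! i, vs ! Suc i} \<in> edges G"
    by blast
  show ?case
  proof (cases "y \<in> set vs")
    case True
    then obtain j where j: "j < length vs" "vs ! j = y"
      by (meson in_set_conv_nth)
    have "last (take (Suc j) vs) = y" using j by (simp add: take_Suc_conv_app_nth)
    then show ?thesis using vs by (intro exI[of _ "take (Suc j) vs"]) auto
  next
    case False
    have "{(vs @ [y]) ! i, (vs @ [y]) ! Suc i} \<in> edges G" if i: "Suc i < length (vs @ [y])" for i
    proof (cases "Suc i < length vs")
      case True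
      then show ?thesis using vs(5) by (simp add: nth_append)
    next
      case False
      with i have "i = length vs - 1" "Suc i = length vs" by auto
      then show ?thesis using vs(1,4) step(2) by (simp add: nth_append last_conv_nth)
    qed
    then show ?thesis
      using vs False by (intro exI[of _ "vs @ [y]"]) auto
  qed
qed

section \<open>The two sides of a tree edge\<close>

text \<open>A path from \<open>s\<close> to \<open>t\<close> avoiding the edge would be closed to a
  cycle by it. Such a path has at least three vertices, since \<open>s\<close> and \<open>t\<close>
  differ and the path with two vertices would use the deleted edge.\<close>

lemma tree_edge_bridge:
  assumes "is_tree T" "{s, t} \<in> edges T"
  shows "\<not> reachable (delete_edge T {s, t}) s t"
proof
  assume "reachable (delete_edge T {s, t}) s t"
  from reachable_imp_distinct_path[OF this] obtain vs where
    vs: "vs \<noteq> []" "distinct vs" "hd vs = s" "last vs = t"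
    and *: "\<forall>i. Suc i < length vs \<longrightarrow> {vs ! i, vs ! Suc i} \<in> edges (delete_edge T {s, t})"
    by blast
  have sg: "simple_graph T" using assms(1) by (simp add: is_tree_def)
  then have "card {s, t} = 2" using assms(2) by (auto simp: simple_graph_def)
  then have st: "s \<noteq> t" by auto
  have E: "{vs ! i, vs ! Suc i} \<in> edges T" "{vs ! i, vs ! Suc i} \<noteq> {s, t}"
    if "Suc i < length vs" for i
    using * that by (auto simp: delete_edge_def)
  have "length vs \<noteq> 0" using vs by auto
  moreover have "length vs \<noteq> 1"
    using vs st by (auto simp: length_Suc_conv)
  moreover have "length vs \<noteq> 2"
  proof
    assume l: "length vs = 2"
    then have "vs ! 0 = s" "vs ! Suc 0 = t"
      using vs by (auto simp: hd_conv_nth last_conv_nth)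
    then show False using E(2)[of 0] l by auto
  qed
  ultimately have len: "3 \<le> length vs" by linarith
  have "x \<in> verts T" if "x \<in> set vs" for x
  proof -
    from that obtain i where i: "i < length vs" "vs ! i = x" by (meson in_set_conv_nth)
    show ?thesis
    proof (cases "Suc i < length vs")
      case True
      then show ?thesis using E(1)[OF True] sg i by (auto simp: simple_graph_def)
    next
      case False
      then have "Suc (i - 1) < length vs" "Suc (i - 1) = i" using i len by auto
      then show ?thesis using E(1)[of "i - 1"] sg i by (auto simp: simple_graph_def)
    qed
  qed
  then have "is_cycle T vs"
    using len vs E(1) assms(2) by (auto simp: is_cycle_def insert_commute)
  then show False using assms(1) by (auto simp: is_tree_def)
qed

text \<open>The arguments orient the edge: this is the side of its head \<open>t\<close>, and
  swapping them gives the other side. Within the vertices of the decomposed graph,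
  \<open>edge_side\<close> is the preimage of such a set under \<open>L\<close>.\<close>

definition component :: "'a ugraph \<Rightarrow> 'a \<Rightarrow> 'a \<Rightarrow> 'a set" where
  "component T s t = {v. reachable (delete_edge T {s, t}) t v}"

lemma delete_edge_simple: "simple_graph T \<Longrightarrow> simple_graph (delete_edge T e)"
  by (auto simp: simple_graph_def delete_edge_def)

lemma component_subset:
  assumes "simple_graph T" "{s, t} \<in> edges T"
  shows "component T s t \<subseteq> verts T"
proof
  fix v assume "v \<in> component T s t"
  then have "reachable (delete_edge T {s, t}) t v" by (simp add: component_def)
  from reachable_verts[OF delete_edge_simple[OF assms(1)] this] assms
  show "v \<in> verts T" by (auto simp: delete_edge_def simple_graph_def)
qed

lemma self_in_component: "t \<in> component T s t"
  by (simp add: component_def reachable_refl)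

lemma component_step:
  assumes "x \<in> component T s t" "{x, y} \<in> edges T" "{x, y} \<noteq> {s, t}"
  shows "y \<in> component T s t"
proof -
  have "{x, y} \<in> edges (delete_edge T {s, t})" using assms(2,3) by (simp add: delete_edge_def)
  with assms(1) show ?thesis unfolding component_def mem_Collect_eq by (rule reachable_step)
qed

lemma component_induct [consumes 1, case_names self step]:
  assumes "v \<in> component T s t" "P t"
    and "\<And>x y. x \<in> component T s t \<Longrightarrow> {x, y} \<in> edges T \<Longrightarrow> {x, y} \<noteq> {s, t} \<Longrightarrow> P x \<Longrightarrow> P y"
  shows "P v"
proof -
  have "reachable (delete_edge T {s, t}) t v" using assms(1) by (simp add: component_def)
  then show ?thesis
  proof (induction rule: reachable_induct)
    case (step x y)
    then show ?case using assms(3)[of x y] by (simp add: component_def delete_edge_def)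
  qed (rule assms(2))
qed

text \<open>Along a walk of \<open>T\<close> starting at \<open>t\<close>, only a step along the
  edge between \<open>s\<close> and \<open>t\<close> can change sides, and it lands on
  \<open>s\<close> or \<open>t\<close>.\<close>

lemma components_cover:
  assumes "is_tree T" "{s, t} \<in> edges T"
  shows "verts T = component T s t \<union> component T t s"
proof
  have sg: "simple_graph T" using assms(1) by (simp add: is_tree_def)
  then show "component T s t \<union> component T t s \<subseteq> verts T"
    using component_subset assms(2) by (metis Un_least insert_commute)
  show "verts T \<subseteq> component T s t \<union> component T t s"
  proof
    fix v assume v: "v \<in> verts T"
    have "t \<in> verts T" using sg assms(2) by (auto simp: simple_graph_def)
    then have "reachable T t v" using v assms(1) by (auto simp: is_tree_def connected_graph_def)
    then show "v \<in> component T s t \<union> component T t s"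
    proof (induction rule: reachable_induct)
      case refl
      show ?case by (simp add: self_in_component)
    next
      case (step x y)
      show ?case
      proof (cases "{x, y} = {s, t}")
        case True
        then have "y = s \<or> y = t" by (auto simp: doubleton_eq_iff)
        then show ?thesis by (auto simp: self_in_component)
      next
        case False
        then have "{x, y} \<noteq> {t, s}" by (simp add: insert_commute)
        then show ?thesis using False step(2,3) component_step[of x T s t y] component_step[of x T t s y] by blast
      qed
    qed
  qed
qed

lemma components_disjoint:
  assumes "is_tree T" "{s, t} \<in> edges T"
  shows "component T s t \<inter> component T t s = {}"
proof -
  have False if "v \<in> component T s t" "v \<in> component T t s" for v
  proof -
    have "reachable (delete_edge T {s, t}) t v" "reachable (delete_edge T {s, t}) s v"
      using that by (simp_all add: component_def insert_commute)
    then show False using tree_edge_bridge[OF assms] reachable_trans reachable_sym by metis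
  qed
  then show ?thesis by blast
qed

text \<open>A walk from \<open>t\<close> opens a branch whenever it leaves \<open>t\<close>. Until
  it returns to \<open>t\<close> it cannot use the edge \<open>{t, u}\<close> again, so it stays in
  the branch of \<open>u\<close>.\<close>

lemma component_branches:
  assumes "v \<in> component T s t"
  shows "v = t \<or> (\<exists>u. u \<noteq> s \<and> {t, u} \<in> edges T \<and> v \<in> component T t u)"
  using assms
proof (induction rule: component_induct)
  case (step x y)
  consider "y = t" | "x = t" | "x \<noteq> t" "y \<noteq> t" by blast
  then show ?case
  proof cases
    case 2
    then have "y \<noteq> s" using step(3) by auto
    then show ?thesis using 2 step(2) self_in_component[of y T t] by blast
  next
    case 3
    then obtain u where u: "u \<noteq> s" "{t, u} \<in> edges T" "x \<in> component T t u"
      using step(4) by blast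
    have "{x, y} \<noteq> {t, u}" using 3 by (simp add: doubleton_eq_iff)
    then have "y \<in> component T t u" using component_step[OF u(3) step(2)] by simp
    then show ?thesis using u by blast
  qed simp
qed simp

text \<open>This gives the descent for choosing a minimal side. The branch beyond \<open>u\<close>
  avoids \<open>t\<close>, so walks inside it never use the edge \<open>{s, t}\<close>; and
  \<open>t\<close> itself makes the inclusion strict.\<close>

lemma component_psubset:
  assumes "is_tree T" "{s, t} \<in> edges T" "{t, u} \<in> edges T" "u \<noteq> s"
  shows "component T t u \<subset> component T s t"
proof -
  have nt: "t \<notin> component T t u"
    using components_disjoint[OF assms(1,3)] self_in_component[of t T u] by blast
  have "{t, u} \<noteq> {s, t}" using assms(4) by (auto simp: doubleton_eq_iff)
  then have u: "u \<in> component T s t"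
    using component_step[OF self_in_component assms(3)] by simp
  have "v \<in> component T s t" if "v \<in> component T t u" for v
    using that
  proof (induction rule: component_induct)
    case (step x y)
    have "y \<in> component T t u" using component_step[OF step(1-3)] .
    then have "{x, y} \<noteq> {s, t}" using step(1) nt by (auto simp: doubleton_eq_iff)
    then show ?case using component_step[OF step(4,2)] by simp
  qed (rule u)
  then show ?thesis using nt self_in_component[of t T s] by blast
qed

section \<open>Balanced edges in subcubic trees\<close>

lemma tree_has_edge:
  assumes "is_tree T" "2 \<le> card (verts T)"
  shows "\<exists>s t. {s, t} \<in> edges T"
proof -
  obtain u v where uv: "u \<in> verts T" "v \<in> verts T" "u \<noteq> v"
    using assms(2) by (metis One_nat_def card_le_Suc0_iff_eq card.infinite not_less_eq_eq
        numeral_2_eq_2 zero_le nle_le)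
  then have "reachable T u v" using assms(1) by (auto simp: is_tree_def connected_graph_def)
  then show ?thesis using uv(3) unfolding reachable_def
    by (cases rule: converse_rtranclE) auto
qed

lemma card_other_neighbours:
  assumes "simple_graph T" "degree T t \<le> 3" "{s, t} \<in> edges T"
  shows "finite {u. u \<noteq> s \<and> {t, u} \<in> edges T}" "card {u. u \<noteq> s \<and> {t, u} \<in> edges T} \<le> 2"
proof -
  let ?U = "{u. u \<noteq> s \<and> {t, u} \<in> edges T}" and ?E = "{e \<in> edges T. t \<in> e}"
  have "edges T \<subseteq> Pow (verts T)" using assms(1) by (auto simp: simple_graph_def)
  then have fin: "finite ?E"
    using assms(1) by (metis (no_types, lifting) finite_Pow_iff finite_subset mem_Collect_eq
        simple_graph_def subsetI subset_iff)
  have inj: "inj_on (\<lambda>u. {t, u}) ?U" by (auto simp: inj_on_def doubleton_eq_iff)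
  have img: "(\<lambda>u. {t, u}) ` ?U \<subseteq> ?E - {{s, t}}" by (auto simp: doubleton_eq_iff)
  show "finite ?U" using inj img fin by (meson finite_Diff inj_on_finite)
  have "card ?U \<le> card (?E - {{s, t}})"
    using inj img fin by (meson card_inj_on_le finite_Diff)
  also have "\<dots> = card ?E - 1" using assms(3) fin by (intro card_Diff_singleton) auto
  finally show "card ?U \<le> 2" using assms(2) by (simp add: degree_def)
qed

text \<open>
  The directed edge is one whose head side has more than \<open>M\<close> marked nodes and is minimal
  with this property, so each of the at most two branches beyond it has at most \<open>M\<close> of them.
\<close>

lemma balanced_edge:
  assumes T: "subcubic_tree T" and Y: "Y \<subseteq> verts T" "3 * M + 1 < card Y"
  shows "\<exists>s t. {s, t} \<in> edges T \<and> M < card (Y \<inter> component T s t)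
           \<and> M < card (Y \<inter> component T t s)"
proof -
  have tree: "is_tree T" and sg: "simple_graph T" and card2: "2 \<le> card (verts T)"
    using T by (auto simp: subcubic_tree_def is_tree_def)
  have finV: "finite (verts T)" using sg by (simp add: simple_graph_def)
  then have finY: "finite Y" using Y finite_subset by blast
  have split: "card Y \<le> card (Y \<inter> component T s t) + card (Y \<inter> component T t s)"
    if "{s, t} \<in> edges T" for s t
  proof -
    have "Y = (Y \<inter> component T s t) \<union> (Y \<inter> component T t s)"
      using components_cover[OF tree that] Y by auto
    then show ?thesis by (metis card_Un_le)
  qed
  define Q where "Q = (\<lambda>(s, t). {s, t} \<in> edges T \<and> M < card (Y \<inter> component T s t))"
  obtain s0 t0 where e0: "{s0, t0} \<in> edges T" using tree_has_edge[OF tree card2] by blast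
  \<comment> \<open>If neither orientation qualified, \<open>Y\<close> would have at most
    \<open>2 * M\<close> elements.\<close>
  have "Q (s0, t0) \<or> Q (t0, s0)"
    using split[OF e0] e0 Y(2) by (auto simp: Q_def insert_commute)
  then obtain p0 where "Q p0" by blast
  then obtain p where p: "Q p"
    "\<And>q. Q q \<Longrightarrow> card (component T (fst p) (snd p)) \<le> card (component T (fst q) (snd q))"
    using ex_has_least_nat[of Q p0 "\<lambda>q. card (component T (fst q) (snd q))"] by blast
  obtain s t where st: "p = (s, t)" by (cases p)
  have e: "{s, t} \<in> edges T" and big: "M < card (Y \<inter> component T s t)"
    using p(1) st by (auto simp: Q_def)
  define U where "U = {u. u \<noteq> s \<and> {t, u} \<in> edges T}"
  have "t \<in> verts T" using e sg by (auto simp: simple_graph_def)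
  then have U: "finite U" "card U \<le> 2"
    using card_other_neighbours[OF sg _ e] T by (auto simp: U_def subcubic_tree_def)
  have small: "card (Y \<inter> component T t u) \<le> M" if "u \<in> U" for u
  proof (rule ccontr)
    assume "\<not> ?thesis"
    then have "Q (t, u)" using that by (auto simp: Q_def U_def)
    from p(2)[OF this] have "card (component T s t) \<le> card (component T t u)" by (simp add: st)
    moreover have "component T t u \<subset> component T s t"
      using component_psubset[OF tree e] that by (auto simp: U_def)
    ultimately show False
      using finite_subset[OF component_subset[OF sg e] finV] by (meson psubset_card_mono leD)
  qed
  \<comment> \<open>The threshold \<open>3 * M + 1\<close> comes from here: \<open>t\<close> may be
    marked and each of the two branches holds at most \<open>M\<close> marked nodes, so the head
    side has at most \<open>2 * M + 1\<close>, and more than \<open>M\<close> remain for the other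
    side.\<close>
  have "Y \<inter> component T s t \<subseteq> {t} \<union> (\<Union>u\<in>U. Y \<inter> component T t u)"
    using component_branches by (fastforce simp: U_def)
  then have "card (Y \<inter> component T s t) \<le> card ({t} \<union> (\<Union>u\<in>U. Y \<inter> component T t u))"
    using U finY by (intro card_mono) auto
  also have "\<dots> \<le> 1 + card (\<Union>u\<in>U. Y \<inter> component T t u)"
    using card_Un_le[of "{t}"] by (metis card_1_singleton_iff One_nat_def)
  also have "card (\<Union>u\<in>U. Y \<inter> component T t u) \<le> (\<Sum>u\<in>U. card (Y \<inter> component T t u))"
    using U(1) by (rule card_UN_le)
  also have "\<dots> \<le> (\<Sum>u\<in>U. M)" using small by (intro sum_mono)
  also have "\<dots> \<le> 2 * M" using U(2) by simp
  finally have "card (Y \<inter> component T s t) \<le> 1 + 2 * M" by simp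
  then have "M < card (Y \<inter> component T t s)" using split[OF e] Y(2) by linarith
  then show ?thesis using e big by blast
qed

section \<open>Counting distinct rows by rank over GF(2)\<close>

text \<open>Coefficients over GF(2) are 0 or 1, so every row is the sum of a subset of a basis
  chosen among the rows.\<close>

lemma card_rows_le:
  assumes "finite A"
  shows "card (cut_row G A ` A) \<le> 2 ^ cutrank G A"
proof -
  interpret vector_space bit_scale by (rule vector_space_bit_scale)
  let ?S = "cut_row G A ` A"
  obtain B where B: "B \<subseteq> ?S" "independent B" "?S \<subseteq> span B" "card B = dim ?S"
    using basis_exists by blast
  have fin: "finite B" using B(1) assms finite_subset by blast
  have "span B \<subseteq> (\<lambda>C. \<Sum>C) ` Pow B"
  proof
    fix f assume "f \<in> span B"
    then obtain u where u: "f = (\<Sum>v\<in>B. bit_scale (u v) v)"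
      using span_finite[OF fin] by auto
    have "f = (\<Sum>v\<in>B. if u v = 1 then v else 0)"
      unfolding u by (intro sum.cong refl) (auto simp: fun_eq_iff)
    also have "\<dots> = \<Sum>{v \<in> B. u v = 1}" using fin by (simp add: sum.inter_filter)
    finally show "f \<in> (\<lambda>C. \<Sum>C) ` Pow B" by blast
  qed
  then have "card ?S \<le> card ((\<lambda>C. \<Sum>C) ` Pow B)"
    using B(3) fin by (intro card_mono) auto
  also have "\<dots> \<le> card (Pow B)" using fin by (intro card_image_le) simp
  finally show ?thesis using B(4) fin by (simp add: card_Pow cutrank_def)
qed


section \<open>Existence of rank decompositions, by caterpillars\<close>

text \<open>Used with \<open>p v < v\<close>, so that every node is numbered after its parent and
  the order of the naturals rules out cycles.\<close>

definition parent_tree :: "(nat \<Rightarrow> nat) \<Rightarrow> nat \<Rightarrow> nat ugraph" where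
  "parent_tree p N = ({..<N}, {{v, p v} | v. 0 < v \<and> v < N})"

lemma parent_tree_connected:
  assumes "\<And>v. 0 < v \<Longrightarrow> p v < v" "v < N"
  shows "reachable (parent_tree p N) 0 v"
  using assms(2)
proof (induction v rule: less_induct)
  case (less v)
  show ?case
  proof (cases "v = 0")
    case False
    then have "reachable (parent_tree p N) 0 (p v)" using less assms(1)[of v] by auto
    moreover have "{p v, v} \<in> edges (parent_tree p N)"
      using False less.prems by (auto simp: parent_tree_def insert_commute)
    ultimately show ?thesis by (rule reachable_step)
  qed (simp add: reachable_refl)
qed

text \<open>Indices modulo the length treat the closing edge like the others, so the maximum of a
  cycle may sit at any position.\<close>

lemma is_cycle_cyclic_edge:
  assumes "is_cycle G vs" "i < length vs"
  shows "{vs ! i, vs ! (Suc i mod length vs)} \<in> edges G"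
proof (cases "Suc i < length vs")
  case True
  then show ?thesis using assms by (simp add: is_cycle_def)
next
  case False
  then have "i = length vs - 1" "Suc i = length vs" using assms(2) by auto
  moreover have "vs \<noteq> []" using assms(2) by auto
  ultimately show ?thesis using assms(1) by (simp add: is_cycle_def last_conv_nth hd_conv_nth)
qed

text \<open>The largest node of a cycle would have two distinct smaller neighbours.\<close>

lemma parent_tree_acyclic:
  assumes p: "\<And>v. 0 < v \<Longrightarrow> p v < v"
  shows "\<not> is_cycle (parent_tree p N) vs"
proof
  assume c: "is_cycle (parent_tree p N) vs"
  define l where "l = length vs"
  have l: "3 \<le> l" and dist: "distinct vs" using c by (auto simp: is_cycle_def l_def)
  then have "set vs \<noteq> {}" by (auto simp: l_def)
  then have "Max (set vs) \<in> set vs" by (intro Max_in) auto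
  then obtain i where i: "i < l" "vs ! i = Max (set vs)"
    unfolding in_set_conv_nth l_def by blast
  \<comment> \<open>Every edge joins a node to its smaller parent, so a neighbour of the maximum on
    the cycle must be the parent of the maximum.\<close>
  have below: "w = p (vs ! i)" if "{vs ! i, w} \<in> edges (parent_tree p N)" "w \<in> set vs" for w
  proof -
    have "\<exists>v. {vs ! i, w} = {v, p v} \<and> 0 < v \<and> v < N"
      using that(1) by (simp only: parent_tree_def snd_conv mem_Collect_eq)
    then obtain v where v: "{vs ! i, w} = {v, p v}" "0 < v" by blast
    have "w \<le> vs ! i" using i that by simp
    moreover have "vs ! i = v \<and> w = p v \<or> vs ! i = p v \<and> w = v"
      using v(1) by (simp only: doubleton_eq_iff)
    ultimately show ?thesis using p[OF v(2)] by (elim disjE conjE) (simp only:, linarith)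
  qed
  \<comment> \<open>The cyclic successor and predecessor of \<open>i\<close>; they differ because
    the cycle has length at least 3.\<close>
  define a where "a = Suc i mod l"
  define b where "b = (if i = 0 then l - 1 else i - 1)"
  have a: "a = (if Suc i = l then 0 else Suc i)" using i by (auto simp: a_def)
  have ab: "a < l" "b < l" using l i by (auto simp: a b_def)
  have sb: "Suc b mod l = i" using i l by (auto simp: b_def)
  have "a \<noteq> b" using i l by (auto simp: a b_def split: if_splits)
  moreover have "vs ! a = p (vs ! i)"
  proof (rule below)
    show "{vs ! i, vs ! a} \<in> edges (parent_tree p N)"
      using is_cycle_cyclic_edge[OF c i(1)[unfolded l_def]] by (simp only: a_def l_def)
    show "vs ! a \<in> set vs" using ab(1) unfolding l_def by (rule nth_mem)
  qed
  moreover have "vs ! b = p (vs ! i)"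
  proof (rule below)
    have "{vs ! b, vs ! i} \<in> edges (parent_tree p N)"
      using is_cycle_cyclic_edge[OF c ab(2)[unfolded l_def]] sb by (simp only: l_def)
    then show "{vs ! i, vs ! b} \<in> edges (parent_tree p N)" by (simp only: insert_commute)
    show "vs ! b \<in> set vs" using ab(2) unfolding l_def by (rule nth_mem)
  qed
  ultimately show False using nth_eq_iff_index_eq[OF dist, of a b] ab by (simp add: l_def)
qed

lemma parent_tree_is_tree:
  assumes p: "\<And>v. 0 < v \<Longrightarrow> p v < v" and "0 < N"
  shows "is_tree (parent_tree p N)"
proof -
  have "card {v, p v} = 2 \<and> p v < N" if "0 < v" "v < N" for v
    using p[OF that(1)] that by (auto simp: card_insert_if)
  then have "simple_graph (parent_tree p N)"
    by (auto simp: simple_graph_def parent_tree_def)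
  moreover have "connected_graph (parent_tree p N)"
    using parent_tree_connected[of p _ N, OF p] \<open>0 < N\<close>
    by (auto simp: connected_graph_def parent_tree_def intro: reachable_trans reachable_sym)
  ultimately show ?thesis using parent_tree_acyclic[OF p] by (simp add: is_tree_def)
qed

text \<open>
  The caterpillar with spine \<open>1, 3, 5, \<dots>\<close>: its leaves are the even nodes and the last node.
\<close>

definition caterpillar :: "nat \<Rightarrow> nat ugraph" where
  "caterpillar m = parent_tree (\<lambda>v. 2 * (v div 2) - 1) (2 * m + 2)"

text \<open>This lists the children of \<open>t\<close>. Node 1 is exceptional because truncated
  subtraction gives it the parent 0; otherwise the children are \<open>t + 1\<close> and
  \<open>t + 2\<close> for odd \<open>t\<close>.\<close>

lemma caterpillar_parent_iff:
  fixes v :: nat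
  assumes "0 < v"
  shows "2 * (v div 2) - 1 = t \<longleftrightarrow> v = 1 \<and> t = 0 \<or> odd t \<and> (v = t + 1 \<or> v = t + 2)"
proof (cases "even v")
  case True
  then obtain d where "v = 2 * d" by (rule evenE)
  then have "2 * (v div 2) - 1 = t \<longleftrightarrow> v = t + 1" using assms by auto
  then show ?thesis using True assms by (simp only:) auto
next
  case False
  then obtain d where "v = 2 * d + 1" by (rule oddE)
  then show ?thesis using assms by auto
qed

text \<open>An inner odd node has its parent and two children. The last node has only its parent,
  since its children would fall outside the range.\<close>

lemma caterpillar_degree:
  assumes "t < 2 * m + 2"
  shows "degree (caterpillar m) t = (if even t \<or> t = 2 * m + 1 then 1 else 3)"
proof -
  let ?p = "\<lambda>v::nat. 2 * (v div 2) - 1"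
  let ?E = "{e \<in> edges (caterpillar m). t \<in> e}"
  have E: "?E = {{v, ?p v} | v. 0 < v \<and> v < 2 * m + 2 \<and> (v = t \<or> ?p v = t)}"
    by (auto simp: caterpillar_def parent_tree_def)
  consider "t = 0" | "even t" "t > 0" | "odd t" "t = 2 * m + 1" | "odd t" "t < 2 * m + 1"
    using assms by linarith
  then show ?thesis
  proof cases
    case 1
    have "0 < v \<and> v < 2 * m + 2 \<and> (v = t \<or> ?p v = t) \<longleftrightarrow> v = 1" for v
      using 1 caterpillar_parent_iff[of v t] by auto
    then have "?E = {{1, 0}}" unfolding E by auto
    then show ?thesis using 1 by (simp add: degree_def)
  next
    case 2
    have "0 < v \<and> v < 2 * m + 2 \<and> (v = t \<or> ?p v = t) \<longleftrightarrow> v = t" for v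
      using 2 assms caterpillar_parent_iff[of v t] by auto
    then have "?E = {{t, ?p t}}" unfolding E by auto
    then show ?thesis using 2 by (simp add: degree_def)
  next
    case 3
    have "0 < v \<and> v < 2 * m + 2 \<and> (v = t \<or> ?p v = t) \<longleftrightarrow> v = t" for v
      using 3 caterpillar_parent_iff[of v t] by auto
    then have "?E = {{t, ?p t}}" unfolding E by auto
    then show ?thesis using 3 by (simp add: degree_def)
  next
    case 4
    have "0 < v \<and> v < 2 * m + 2 \<and> (v = t \<or> ?p v = t) \<longleftrightarrow> v \<in> {t, t + 1, t + 2}" for v
    proof -
      \<comment> \<open>Since \<open>t\<close> is odd and below \<open>2 * m + 1\<close>, it is at
        most \<open>2 * m - 1\<close>, so \<open>t + 2\<close> is still a node.\<close>
      obtain c where "t = 2 * c + 1" "c < m" using 4 by (auto elim!: oddE)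
      then show ?thesis using caterpillar_parent_iff[of v t] by auto
    qed
    then have "?E = (\<lambda>v. {v, ?p v}) ` {t, t + 1, t + 2}" unfolding E by blast
    moreover have "?p (t + 1) = t" "?p (t + 2) = t" "?p t < t"
      using 4 caterpillar_parent_iff[of "t + 1" t] caterpillar_parent_iff[of "t + 2" t]
      by (auto elim!: oddE)
    ultimately have "?E = {{t, ?p t}, {t + 1, t}, {t + 2, t}}" by simp
    moreover have "card {{t, ?p t}, {t + 1, t}, {t + 2, t}} = 3"
      using \<open>?p t < t\<close> by (simp add: card_insert_if doubleton_eq_iff)
    ultimately show ?thesis using 4 by (simp add: degree_def)
  qed
qed

lemma caterpillar_subcubic: "subcubic_tree (caterpillar m)"
proof -
  have "is_tree (caterpillar m)"
    unfolding caterpillar_def by (rule parent_tree_is_tree) presburger+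
  moreover have "verts (caterpillar m) = {..<2 * m + 2}"
    by (simp add: caterpillar_def parent_tree_def)
  ultimately show ?thesis by (auto simp: subcubic_tree_def caterpillar_degree)
qed

lemma card_caterpillar_leaves: "card (leaves (caterpillar m)) = m + 2"
proof -
  have "verts (caterpillar m) = {..<2 * m + 2}"
    by (simp add: caterpillar_def parent_tree_def)
  moreover have "degree (caterpillar m) t = 1 \<longleftrightarrow> even t \<or> t = 2 * m + 1"
    if "t < 2 * m + 2" for t
    using caterpillar_degree[OF that] by simp
  ultimately have "t \<in> leaves (caterpillar m) \<longleftrightarrow> t < 2 * m + 2 \<and> (even t \<or> t = 2 * m + 1)" for t
    unfolding leaves_def by blast
  also have "t < 2 * m + 2 \<and> (even t \<or> t = 2 * m + 1)
      \<longleftrightarrow> t = 2 * m + 1 \<or> (\<exists>x<m + 1. t = 2 * x)" for t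
    by presburger
  finally have "leaves (caterpillar m) = insert (2 * m + 1) ((*) 2 ` {..<m + 1})" by blast
  moreover have "card (insert (2 * m + 1) ((*) 2 ` {..<m + 1})) = Suc (card ((*) 2 ` {..<m + 1}))"
  proof (rule card_insert_disjoint)
    show "2 * m + 1 \<notin> (*) 2 ` {..<m + 1}" by (metis (no_types) dvd_triv_left even_plus_one_iff imageE)
  qed simp
  moreover have "card ((*) (2::nat) ` {..<m + 1}) = m + 1" by (simp add: card_image inj_on_def)
  ultimately show ?thesis by simp
qed

text \<open>Caterpillars realise every number of leaves from two on, and any bijection onto the
  leaves will do. This ensures that the \<open>Inf\<close> in \<open>rankwidth\<close> is taken over
  a nonempty set and so is the width of an actual decomposition.\<close>

lemma rank_decomposition_exists:
  assumes "2 \<le> card (verts G)"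
  shows "\<exists>T L. rank_decomposition G T L"
proof -
  obtain m where m: "card (verts G) = m + 2" using assms by (metis le_iff_add add.commute)
  have "finite (verts G)" using assms by (metis card.infinite not_numeral_le_zero)
  moreover have "finite (leaves (caterpillar m))"
    using card_caterpillar_leaves[of m] by (metis card.infinite add_2_eq_Suc' nat.distinct(1))
  ultimately obtain L where "bij_betw L (verts G) (leaves (caterpillar m))"
    using finite_same_card_bij card_caterpillar_leaves m by metis
  then show ?thesis using caterpillar_subcubic unfolding rank_decomposition_def by blast
qed

text \<open>A nonempty set of naturals contains its infimum. Finiteness of the tree makes the
  \<open>Max\<close> in the width an upper bound for each single cut.\<close>

lemma rankwidth_attained:
  assumes "2 \<le> card (verts G)"
  obtains T L where "rank_decomposition G T L"
    "\<And>e t. e \<in> edges T \<Longrightarrow> t \<in> e \<Longrightarrow> cutrank G (edge_side G T L e t) \<le> rankwidth G"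
proof -
  let ?W = "{decomposition_width G T L | T L. rank_decomposition G T L}"
  have "Inf ?W \<in> ?W" using rank_decomposition_exists[OF assms] by (intro Inf_nat_def1) auto
  moreover have "rankwidth G = Inf ?W" using assms by (simp add: rankwidth_def)
  ultimately obtain T L where TL: "rank_decomposition G T L"
    "rankwidth G = decomposition_width G T L" by auto
  have sg: "simple_graph T"
    using TL(1) by (simp add: rank_decomposition_def subcubic_tree_def is_tree_def)
  then have "finite (edges T)" "\<And>e. e \<in> edges T \<Longrightarrow> finite e"
    by (auto simp: simple_graph_def intro: finite_subset[of _ "Pow (verts T)"] finite_subset)
  then have "finite (\<Union>e\<in>edges T. (\<lambda>t. cutrank G (edge_side G T L e t)) ` e)" by blast
  also have "(\<Union>e\<in>edges T. (\<lambda>t. cutrank G (edge_side G T L e t)) ` e)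
      = {cutrank G (edge_side G T L e t) | e t. e \<in> edges T \<and> t \<in> e}" by blast
  finally have fin: "finite {cutrank G (edge_side G T L e t) | e t. e \<in> edges T \<and> t \<in> e}" .
  show ?thesis
    by (rule that[OF TL(1)]) (unfold TL(2) decomposition_width_def, rule Max_ge[OF fin], blast)
qed

section \<open>Probes in the edge-clique graph of a cocktail party graph\<close>

text \<open>Two vertices with the same index are equal or matched to each other, so only the indices
  decide adjacency in the complement.\<close>

lemma cp_edge_iff:
  "{u, v} \<in> edges (cp n) \<longleftrightarrow> fst u < n \<and> fst v < n \<and> fst u \<noteq> fst v"
proof -
  obtain i a j b where [simp]: "u = (i, a)" "v = (j, b)" by (cases u, cases v) auto
  show ?thesis
    by (cases a; cases b)
      (auto simp: cp_def complement_def matching_graph_def card_insert_if doubleton_eq_iff)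
qed

text \<open>For distinct indices below \<open>n\<close> these are the edges of the clique formed by
  the \<open>False\<close> vertices of \<open>cp n\<close>.\<close>

definition pos_pair :: "nat \<Rightarrow> nat \<Rightarrow> (nat \<times> bool) set" where
  "pos_pair i j = {(i, False), (j, False)}"

text \<open>The second vertex of the probe is arbitrary, subject to being a different \<open>False\<close> vertex.\<close>

definition probe :: "nat \<Rightarrow> (nat \<times> bool) set" where
  "probe i = {(i, True), (if i = 0 then 1 else 0, False)}"

abbreviation cp_edge_clique :: "nat \<Rightarrow> (nat \<times> bool) set ugraph" where
  "cp_edge_clique n \<equiv> edge_clique_graph (cp n)"

lemma pos_pair_in_verts:
  "pos_pair i j \<in> verts (cp_edge_clique n) \<longleftrightarrow> i < n \<and> j < n \<and> i \<noteq> j"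
  by (simp add: edge_clique_graph_def pos_pair_def cp_edge_iff)

lemma probe_in_verts:
  "2 \<le> n \<Longrightarrow> i < n \<Longrightarrow> probe i \<in> verts (cp_edge_clique n)"
  by (simp add: edge_clique_graph_def probe_def cp_edge_iff)

lemma pos_pair_commute: "pos_pair i j = pos_pair j i"
  by (auto simp: pos_pair_def)

lemma finite_verts_cp_edge_clique: "finite (verts (cp_edge_clique n))"
proof -
  have "verts (cp_edge_clique n) \<subseteq> Pow ({..<n} \<times> UNIV)"
    by (auto simp: edge_clique_graph_def cp_def complement_def matching_graph_def)
  then show ?thesis by (rule finite_subset) simp
qed

lemma edge_clique_adjacent_iff:
  "{e, f} \<in> edges (edge_clique_graph G) \<longleftrightarrow>
    e \<in> edges G \<and> f \<in> edges G \<and> e \<noteq> f \<and> (\<exists>C. clique G C \<and> e \<subseteq> C \<and> f \<subseteq> C)"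
  (is "?L \<longleftrightarrow> ?R")
proof
  assume ?L
  then have "\<exists>e' f'. {e, f} = {e', f'} \<and> e' \<in> edges G \<and> f' \<in> edges G \<and> e' \<noteq> f' \<and>
      (\<exists>C. clique G C \<and> e' \<subseteq> C \<and> f' \<subseteq> C)"
    by (simp only: edge_clique_graph_def snd_conv mem_Collect_eq)
  then show ?R by (elim exE conjE) (auto simp: doubleton_eq_iff)
next
  assume ?R
  then show ?L
    by (simp only: edge_clique_graph_def snd_conv mem_Collect_eq) blast
qed

text \<open>No clique contains both \<open>(i, False)\<close> and \<open>(i, True)\<close>, which
  excludes pairs using \<open>i\<close>. For any other pair its union with the probe is itself a
  clique, because \<open>(i, True)\<close> is the only \<open>True\<close> vertex in it and
  \<open>(i, False)\<close> is absent.\<close>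

lemma adjacent_probe_iff:
  assumes "a < n" "b < n" "a \<noteq> b" "i < n" "2 \<le> n"
  shows "{pos_pair a b, probe i} \<in> edges (cp_edge_clique n) \<longleftrightarrow> i \<noteq> a \<and> i \<noteq> b"
proof
  assume "{pos_pair a b, probe i} \<in> edges (cp_edge_clique n)"
  then obtain C where C: "clique (cp n) C" "pos_pair a b \<subseteq> C" "probe i \<subseteq> C"
    unfolding edge_clique_adjacent_iff by blast
  have "(i, False) \<notin> C"
  proof
    assume "(i, False) \<in> C"
    moreover have "(i, True) \<in> C" using C by (simp add: probe_def)
    ultimately have "{(i, False), (i, True)} \<in> edges (cp n)"
      using C(1) by (simp add: clique_def)
    then show False by (simp add: cp_edge_iff)
  qed
  then show "i \<noteq> a \<and> i \<noteq> b" using C(2) by (auto simp: pos_pair_def)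
next
  assume i: "i \<noteq> a \<and> i \<noteq> b"
  let ?C = "pos_pair a b \<union> probe i"
  have "clique (cp n) ?C"
    unfolding clique_def cp_edge_iff
    using assms i by (auto simp: pos_pair_def probe_def cp_def complement_def matching_graph_def)
  moreover have "pos_pair a b \<noteq> probe i" by (auto simp: pos_pair_def probe_def doubleton_eq_iff)
  ultimately show "{pos_pair a b, probe i} \<in> edges (cp_edge_clique n)"
    using pos_pair_in_verts[of a b n] probe_in_verts[of n i] assms
    unfolding edge_clique_adjacent_iff by (auto simp: edge_clique_graph_def)
qed

text \<open>The row of \<open>pos_pair a b\<close> determines which of \<open>a\<close>, \<open>b\<close> have their probe outside \<open>A\<close>.\<close>

lemma card_probed_le:
  fixes A :: "(nat \<times> bool) set set"
  assumes n: "2 \<le> n" and A: "finite A" "cutrank (cp_edge_clique n) A \<le> k"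
  shows "card {i. i < n \<and> probe i \<notin> A \<and> (\<exists>j. j < n \<and> j \<noteq> i \<and> pos_pair i j \<in> A)} \<le> 2 * 2 ^ k"
    (is "card ?D \<le> _")
proof -
  let ?G = "cp_edge_clique n"
  let ?R = "cut_row ?G A ` A"
  define S where "S = {i. i < n \<and> probe i \<notin> A}"
  define g where "g r = {i \<in> S. r (probe i) = (0::bit)}" for r
  have g: "g (cut_row ?G A (pos_pair a b)) = {a, b} \<inter> S" if "a < n" "b < n" "a \<noteq> b" for a b
    using that adjacent_probe_iff[OF that] probe_in_verts[OF n] n
    by (auto simp: g_def S_def cut_row_def)
  \<comment> \<open>\<open>A\<close> may contain edges with a \<open>True\<close> end, whose rows
    can vanish on many probes. The filter discards such large zero sets and keeps all those coming
    from pairs; each remaining set covers at most two indices, hence the factor 2.\<close>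
  let ?F = "{X \<in> g ` ?R. card X \<le> 2}"
  have "?D \<subseteq> \<Union>?F"
  proof
    fix i assume i: "i \<in> ?D"
    then obtain j where j: "j < n" "j \<noteq> i" "pos_pair i j \<in> A" by auto
    let ?X = "g (cut_row ?G A (pos_pair i j))"
    have X: "?X = {i, j} \<inter> S" using g i j by simp
    have "card ?X \<le> card {i, j}" unfolding X by (intro card_mono) auto
    then have "card ?X \<le> 2" using j by (simp add: card_insert_if)
    moreover have "i \<in> ?X" unfolding X using i by (simp add: S_def)
    ultimately show "i \<in> \<Union>?F" using j(3) by blast
  qed
  moreover have "finite (\<Union>?F)" by (rule finite_subset[of _ S]) (auto simp: g_def S_def)
  ultimately have "card ?D \<le> card (\<Union>?F)" by (rule card_mono[rotated])
  also have "\<dots> \<le> sum card ?F" by (rule card_Union_le_sum_card)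
  also have "\<dots> \<le> (\<Sum>X\<in>?F. 2)" by (intro sum_mono) auto
  also have "\<dots> \<le> 2 * card (g ` ?R)" using A(1) by (auto intro!: card_mono)
  also have "card (g ` ?R) \<le> card ?R" using A(1) by (intro card_image_le) simp
  also have "card ?R \<le> 2 ^ k"
    using card_rows_le[OF A(1), of ?G] A(2) by (meson le_trans one_le_numeral power_increasing)
  finally show ?thesis by simp
qed

section \<open>Low-rank cuts leave the star at \<open>(0, False)\<close> unbalanced\<close>

lemma star_unbalanced:
  assumes n: "2 \<le> n" and AB: "verts (cp_edge_clique n) = A \<union> B" "A \<inter> B = {}"
    and k: "cutrank (cp_edge_clique n) A \<le> k" "cutrank (cp_edge_clique n) B \<le> k"
  defines "X \<equiv> pos_pair 0 ` {1..<n}"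
  shows "card (X \<inter> A) \<le> 4 * 2 ^ k \<or> card (X \<inter> B) \<le> 4 * 2 ^ k"
proof -
  \<comment> \<open>The exceptional indices. Each side contributes at most \<open>2 * 2 ^ k\<close>
    of them, which explains the bound \<open>4 * 2 ^ k\<close>.\<close>
  define D where "D C = {i. i < n \<and> probe i \<notin> C \<and> (\<exists>j. j < n \<and> j \<noteq> i \<and> pos_pair i j \<in> C)}" for C
  have "finite (A \<union> B)" using finite_verts_cp_edge_clique[of n] unfolding AB(1) .
  then have fin: "finite A" "finite B" "finite (D A \<union> D B)" by (auto simp: D_def)
  have "card (D A) \<le> 2 * 2 ^ k" "card (D B) \<le> 2 * 2 ^ k"
    using card_probed_le[OF n fin(1) k(1)] card_probed_le[OF n fin(2) k(2)]
    unfolding D_def by blast+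
  then have D: "card (D A \<union> D B) \<le> 4 * 2 ^ k"
    using card_Un_le[of "D A" "D B"] by linarith
  \<comment> \<open>If \<open>C\<close> contains no probe of an unexceptional index, a star edge to
    \<open>j\<close> lying in \<open>C\<close> forces \<open>j\<close> to be exceptional: otherwise
    its probe is outside \<open>C\<close>, and the star edge puts \<open>j\<close> into
    \<open>D C\<close>. So exceptional indices bound the star edges in \<open>C\<close>.\<close>
  have few: "card (X \<inter> C) \<le> 4 * 2 ^ k"
    if C: "\<And>j. j < n \<Longrightarrow> j \<notin> D A \<union> D B \<Longrightarrow> probe j \<notin> C" "C = A \<or> C = B" for C
  proof -
    have "X \<inter> C \<subseteq> pos_pair 0 ` (D A \<union> D B)"
    proof
      fix x assume "x \<in> X \<inter> C"
      then obtain j where j: "1 \<le> j" "j < n" "x = pos_pair 0 j" "x \<in> C"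
        by (auto simp: X_def)
      then have jC: "pos_pair j 0 \<in> C" by (simp add: pos_pair_commute[of j 0])
      have "j \<in> D A \<union> D B"
      proof (rule ccontr)
        assume nj: "j \<notin> D A \<union> D B"
        have "j \<in> D C" using C(1)[OF j(2) nj] j n jC by (auto simp: D_def intro!: exI[of _ 0])
        then show False using C(2) nj by auto
      qed
      then show "x \<in> pos_pair 0 ` (D A \<union> D B)" using j by blast
    qed
    then have "card (X \<inter> C) \<le> card (D A \<union> D B)" using fin(3) by (rule surj_card_le[rotated])
    then show ?thesis using D by linarith
  qed
  show ?thesis
  proof (cases "\<forall>j<n. j \<notin> D A \<union> D B \<longrightarrow> probe j \<notin> A")
    case True
    then show ?thesis using few[of A] by blast
  next
    case False
    then obtain i where i: "i < n" "i \<notin> D A \<union> D B" "probe i \<in> A" by blast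
    \<comment> \<open>If the unexceptional \<open>i\<close> and \<open>j\<close> had probes on
      opposite sides, the pair \<open>pos_pair i j\<close> could lie on neither side.\<close>
    have "probe j \<notin> B" if j: "j < n" "j \<notin> D A \<union> D B" for j
    proof
      assume B: "probe j \<in> B"
      then have "i \<noteq> j" using i(3) AB(2) by blast
      then have "pos_pair i j \<in> A \<union> B" using i(1) j(1) pos_pair_in_verts[of i j n] unfolding AB(1) by blast
      moreover have "pos_pair i j \<notin> B"
      proof
        assume "pos_pair i j \<in> B"
        moreover have "probe i \<notin> B" using i(3) AB(2) by blast
        ultimately have "i \<in> D B" using i(1) j(1) \<open>i \<noteq> j\<close> unfolding D_def by blast
        then show False using i(2) by blast
      qed
      moreover have "pos_pair i j \<notin> A"
      proof
        assume "pos_pair i j \<in> A"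
        then have "pos_pair j i \<in> A" by (simp add: pos_pair_commute[of j i])
        moreover have "probe j \<notin> A" using B AB(2) by blast
        ultimately have "j \<in> D A" using i(1) j(1) \<open>i \<noteq> j\<close> unfolding D_def by blast
        then show False using j(2) by blast
      qed
      ultimately show False by blast
    qed
    then show ?thesis using few[of B] by blast
  qed
qed

section \<open>Unbounded rankwidth\<close>

theorem theorem7: "\<forall>k::nat. \<exists>n::nat. rankwidth (edge_clique_graph (cp n)) > k"
proof (intro allI, rule ccontr)
  fix k :: nat
  assume "\<not> (\<exists>n. rankwidth (cp_edge_clique n) > k)"
  then have rw: "rankwidth (cp_edge_clique n) \<le> k" for n by (simp add: not_less)
  \<comment> \<open>\<open>M\<close> is the bound of \<open>star_unbalanced\<close>. The star has
    \<open>n - 1\<close> edges, so \<open>n = 3 * M + 3\<close> is the least choice that exceeds the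
    threshold \<open>3 * M + 1\<close> of \<open>balanced_edge\<close>.\<close>
  define M :: nat where "M = 4 * 2 ^ k"
  define n where "n = 3 * M + 3"
  let ?G = "cp_edge_clique n"
  define X where "X = pos_pair 0 ` {1..<n}"
  have n: "2 \<le> n" by (simp add: n_def)
  have "inj_on (pos_pair 0) {1..<n}" by (auto simp: inj_on_def pos_pair_def doubleton_eq_iff)
  then have cX: "card X = 3 * M + 2" by (simp add: X_def card_image n_def)
  have XV: "X \<subseteq> verts ?G" using n pos_pair_in_verts[of 0] by (auto simp: X_def)
  then have "card X \<le> card (verts ?G)" using finite_verts_cp_edge_clique by (intro card_mono)
  then have "2 \<le> card (verts ?G)" using cX by linarith
  then obtain T L where TL: "rank_decomposition ?G T L"
    "\<And>e t. e \<in> edges T \<Longrightarrow> t \<in> e \<Longrightarrow> cutrank ?G (edge_side ?G T L e t) \<le> rankwidth ?G"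
    using rankwidth_attained by blast
  have T: "subcubic_tree T" and tree: "is_tree T"
    and bij: "bij_betw L (verts ?G) (leaves T)"
    using TL(1) by (auto simp: rank_decomposition_def subcubic_tree_def)
  have inj: "inj_on L (verts ?G)" using bij by (simp add: bij_betw_def)
  have LV: "L v \<in> verts T" if "v \<in> verts ?G" for v
    using bij that by (auto simp: bij_betw_def leaves_def)
  have "card (L ` X) = card X" using inj XV by (meson card_image inj_on_subset)
  then have "3 * M + 1 < card (L ` X)" "L ` X \<subseteq> verts T" using cX LV XV by auto
  then obtain s t where e: "{s, t} \<in> edges T"
    and big: "M < card (L ` X \<inter> component T s t)" "M < card (L ` X \<inter> component T t s)"
    using balanced_edge[OF T] by meson
  define A where "A = edge_side ?G T L {s, t} t"
  define B where "B = edge_side ?G T L {s, t} s"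
  have A: "A = {v \<in> verts ?G. L v \<in> component T s t}"
    by (simp add: A_def edge_side_def component_def)
  have B: "B = {v \<in> verts ?G. L v \<in> component T t s}"
    by (simp add: B_def edge_side_def component_def insert_commute)
  have AB: "verts ?G = A \<union> B" "A \<inter> B = {}"
    using components_cover[OF tree e] components_disjoint[OF tree e] LV by (auto simp: A B)
  \<comment> \<open>The width ranges over both ends of each tree edge, so it bounds the cutrank of
    \<open>A\<close> and of \<open>B\<close> directly, without appeal to symmetry of
    \<open>cutrank\<close>.\<close>
  have ranks: "cutrank ?G A \<le> k" "cutrank ?G B \<le> k"
    using TL(2)[OF e] rw[of n] unfolding A_def B_def by (meson insertCI le_trans)+
  have "finite X" by (simp add: X_def)
  have "L ` X \<inter> component T s t \<subseteq> L ` (X \<inter> A)" "L ` X \<inter> component T t s \<subseteq> L ` (X \<inter> B)"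
    using XV by (auto simp: A B)
  then have "M < card (X \<inter> A)" "M < card (X \<inter> B)"
    using big \<open>finite X\<close> by (meson finite_Int less_le_trans surj_card_le)+
  then show False using star_unbalanced[OF n AB ranks] by (auto simp: X_def M_def)
qed

end
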